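(* Let $X$ be a real locally convex Hausdorff topological vector space, $\mathscr P_0(X^* )$ the set of nonempty weak*-closed convex subsets of $X^*$, $T$ a nonempty index set, $\emptyset\ne\mathcal U_t\subset\mathscr P_0(X^* )\times\mathbb R$ for each $t\in T$, and $\mathfrak V:=\bigcup_{t\in T}\mathcal U_t$. Assume that the system $\sigma_{\mathcal A}(x)\le b$ for all $(\mathcal A,b)\in\mathfrak V$ has a solution $x\in X$. The following statements are equivalent: (i) For all $(c,s)\in X^*\times\mathbb R$ the next two assertions are equivalent: $\quad(\alpha'')$ for every $x\in X$: $\ \big[\sigma_{\mathcal A_t}(x)\le b_t\ \ \forall(\mathcal A_t,b_t)\in\mathcal U_t,\ \forall t\in T\big]\Longrightarrow\langle c,x\rangle\ge s$; $\quad(\beta'')$ there exist $\bar V\in\mathfrak V$, $(\bar x^*,\bar r)\in\bar V$ and $\bar\lambda\ge0$ such that $\bar\lambda\bar x^*=-c$ and $\bar\lambda\bar r\le-s$. (ii) $\operatorname{cone}\Big(\bigcup_{V\in\mathfrak V}V\Big)+\mathbb R_+(0_{X^*},1)$ is a closed and convex subset of $X^*\times\mathbb R$.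
   Context: $X^*$ is the topological dual of $X$ with the weak* topology; $X^*\times\mathbb R$ has the product topology. $\sigma_{\mathcal A}(x)=\sup_{x^*\in\mathcal A}\langle x^*,x\rangle$. A pair $V=(V^1,V^2)\in\mathscr P_0(X^* )\times\mathbb R$ is identified with the subset $V^1\times\{V^2\}$ of $X^*\times\mathbb R$. $\operatorname{cone}B=\{\lambda b:\lambda\ge0,b\in B\}$. *)

theory Defs
  imports "HOL-Analysis.Analysis"
begin

section \<open>Locally convex Hausdorff spaces\<close>

text \<open>Continuity of scalar multiplication is stated as in the library class
  \<open>topological_monoid_add\<close>: \<open>nhds r \<times>\<^sub>F nhds a\<close> is the neighbourhood filter of
  \<open>(r, a)\<close> in the product topology. The constant \<open>convex\<close> cannot be used inside a class
  specification, so \<open>locally_convex_raw\<close> spells out its definition; see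
  \<open>locally_convex\<close>.\<close>

class locally_convex_t2 = real_vector + t2_space + topological_ab_group_add +
  assumes tendsto_scaleR_Pair:
    "LIM x (nhds r \<times>\<^sub>F nhds a). fst x *\<^sub>R snd x :> nhds (r *\<^sub>R a)"
  assumes locally_convex_raw:
    "open U \<Longrightarrow> 0 \<in> U \<Longrightarrow> \<exists>V. open V \<and>
       (\<forall>x\<in>V. \<forall>y\<in>V. \<forall>u\<ge>0. \<forall>v\<ge>0. u + v = 1 \<longrightarrow> u *\<^sub>R x + v *\<^sub>R y \<in> V) \<and>
       0 \<in> V \<and> V \<subseteq> U"

lemma locally_convex:
  fixes U :: "'a::locally_convex_t2 set"
  assumes "open U" "0 \<in> U"
  shows "\<exists>V. open V \<and> convex V \<and> 0 \<in> V \<and> V \<subseteq> U"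
  using locally_convex_raw[OF assms] by (simp add: convex_def)


section \<open>The topological dual with its weak* topology\<close>

typedef (overloaded) 'a dual =
  "{f :: 'a::locally_convex_t2 \<Rightarrow> real. linear f \<and> continuous_on UNIV f}"
  morphisms dual_apply Abs_dual
  by (rule exI[of _ "\<lambda>_. 0"]) (simp add: linear_zero)

setup_lifting type_definition_dual

lemma dual_eqI: "(\<And>x. dual_apply f x = dual_apply g x) \<Longrightarrow> f = g"
  by (simp add: dual_apply_inject[symmetric] fun_eq_iff)

lemma linear_dual_apply: "linear (dual_apply f)"
  using dual_apply[of f] by simp

lemma continuous_dual_apply: "continuous_on UNIV (dual_apply f)"
  using dual_apply[of f] by simp

instantiation dual :: (locally_convex_t2) real_vector
begin

lift_definition zero_dual :: "'a dual" is "\<lambda>_. 0"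
  by (simp add: linear_zero)

lift_definition plus_dual :: "'a dual \<Rightarrow> 'a dual \<Rightarrow> 'a dual" is "\<lambda>f g x. f x + g x"
  by (simp add: linear_compose_add continuous_on_add)

lift_definition uminus_dual :: "'a dual \<Rightarrow> 'a dual" is "\<lambda>f x. - f x"
  by (simp add: linear_compose_neg continuous_on_minus)

lift_definition minus_dual :: "'a dual \<Rightarrow> 'a dual \<Rightarrow> 'a dual" is "\<lambda>f g x. f x - g x"
  by (simp add: linear_compose_sub continuous_on_diff)

lift_definition scaleR_dual :: "real \<Rightarrow> 'a dual \<Rightarrow> 'a dual" is "\<lambda>c f x. c * f x"
  using linear_compose_scale_right continuous_on_mult_left by fastforce

instance
  by standard (transfer; simp add: fun_eq_iff algebra_simps)+

end

text \<open>The library gives \<open>'a \<Rightarrow> real\<close> the topology of pointwise convergence; the weak*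
  topology is the one induced from it, i.e. the coarsest for which every evaluation
  \<open>f \<mapsto> \<langle>f, x\<rangle>\<close> is continuous.\<close>

instantiation dual :: (locally_convex_t2) topological_space
begin

definition open_dual :: "'a dual set \<Rightarrow> bool" where
  "open_dual U \<longleftrightarrow> (\<exists>W. open W \<and> U = dual_apply -` W)"

instance
proof
  show "open (UNIV :: 'a dual set)"
    unfolding open_dual_def by (intro exI[of _ UNIV]) simp
next
  fix S T :: "'a dual set"
  assume "open S" "open T"
  then show "open (S \<inter> T)"
    unfolding open_dual_def by (metis open_Int vimage_Int)
next
  fix K :: "'a dual set set"
  assume "\<forall>S\<in>K. open S"
  then obtain W where W: "\<And>S. S \<in> K \<Longrightarrow> open (W S) \<and> S = dual_apply -` W S"
    unfolding open_dual_def by metis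
  then have "\<Union>K = dual_apply -` (\<Union>S\<in>K. W S)" by blast
  with W show "open (\<Union>K)"
    unfolding open_dual_def by (intro exI[of _ "\<Union>S\<in>K. W S"]) auto
qed

end


section \<open>Support functions, uncertainty sets and generated cones\<close>

definition support_fun :: "'a::locally_convex_t2 dual set \<Rightarrow> 'a \<Rightarrow> ereal" where
  "support_fun A x = (SUP f\<in>A. ereal (dual_apply f x))"

definition P0_dual :: "'a::locally_convex_t2 dual set set" where
  "P0_dual = {A. A \<noteq> {} \<and> closed A \<and> convex A}"

text \<open>The identification of \<open>V = (V\<^sup>1, V\<^sup>2)\<close> with the set \<open>V\<^sup>1 \<times> {V\<^sup>2}\<close>.\<close>

definition pair_set :: "'b set \<times> real \<Rightarrow> ('b \<times> real) set" where
  "pair_set V = fst V \<times> {snd V}"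

text \<open>Only nonnegative multiples, without convexification. (The library's \<open>cone\<close> is
  the predicate of being closed under nonnegative scaling.)\<close>

definition generated_cone :: "'b::real_vector set \<Rightarrow> 'b set" where
  "generated_cone B = {\<mu> *\<^sub>R b |\<mu> b. 0 \<le> \<mu> \<and> b \<in> B}"

end

theory Submission
  imports Defs
begin

text \<open>Let \<open>K\<close> be the set in (ii) and \<open>P\<close> the set of all \<open>(f, r)\<close> with \<open>f x \<le> r\<close> for every
  solution \<open>x\<close>. Up to the sign change \<open>(c, s) \<mapsto> (-c, -s)\<close>, assertion (i) says \<open>K = P\<close>.
  Since \<open>P\<close> is closed and convex, (i) implies (ii). Conversely, a point of \<open>P - K\<close> would be
  separated from the closed convex cone \<open>K\<close> by a functional \<open>(f, r) \<mapsto> f x + t * r\<close> that is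
  nonnegative on \<open>K\<close>, so \<open>t \<ge> 0\<close>. If \<open>t > 0\<close>, then \<open>- x / t\<close> is a solution violating
  membership in \<open>P\<close>; if \<open>t = 0\<close>, then \<open>- x\<close> is a recession direction of the solution set along
  which the bound fails. Separation is a finite-dimensional matter, because a weak* neighbourhood
  only involves finitely many evaluations.\<close>

section \<open>Separation by finitely many functionals\<close>

lemma sum_power2_add:
  fixes f g :: "'b \<Rightarrow> real"
  shows "(\<Sum>i\<in>I. (f i + t * g i)\<^sup>2) =
    (\<Sum>i\<in>I. (f i)\<^sup>2) + 2 * t * (\<Sum>i\<in>I. f i * g i) + t\<^sup>2 * (\<Sum>i\<in>I. (g i)\<^sup>2)"
  by (simp add: power2_sum power_mult_distrib sum.distrib sum_distrib_left algebra_simps)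

text \<open>Dividing by \<open>2 * t\<close> and letting \<open>t\<close> decrease to 0 leaves only
  \<open>a\<close>. This is the first-order condition for a minimum along a segment.\<close>

lemma linear_term_nonneg:
  fixes a b :: real
  assumes "\<And>t. 0 < t \<Longrightarrow> t \<le> 1 \<Longrightarrow> 0 \<le> 2 * t * a + t\<^sup>2 * b"
  shows "0 \<le> a"
proof (rule tendsto_lowerbound)
  have "((\<lambda>t. a + t * (b / 2)) \<longlongrightarrow> a + 0 * (b / 2)) (at_right 0)"
    by (intro tendsto_intros)
  then show "((\<lambda>t. a + t * (b / 2)) \<longlongrightarrow> a) (at_right 0)"
    by simp
  have "0 \<le> a + t * (b / 2)" if "0 < t" "t < 1" for t
  proof -
    have "0 \<le> 2 * t * (a + t * (b / 2))"
      using assms[of t] that by (simp add: algebra_simps power2_eq_square)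
    then show ?thesis
      using that by (simp add: zero_le_mult_iff)
  qed
  then show "\<forall>\<^sub>F t in at_right 0. 0 \<le> a + t * (b / 2)"
    unfolding eventually_at_right_field by (intro exI[of _ 1]) auto
qed simp

text \<open>The weights are the coordinates of the point of minimal Euclidean norm in the closure of the
  image of \<open>S\<close>; a minimizing sequence is Cauchy by the parallelogram law.\<close>

lemma separate_zero_finite_functionals:
  fixes S :: "'v::real_vector set" and l :: "'b \<Rightarrow> 'v \<Rightarrow> real"
  assumes "convex S" "finite I"
    and lin: "\<And>i. i \<in> I \<Longrightarrow> linear (l i)"
    and away: "\<And>y. y \<in> S \<Longrightarrow> e \<le> (\<Sum>i\<in>I. (l i y)\<^sup>2)"
  shows "\<exists>w. \<forall>y\<in>S. e \<le> (\<Sum>i\<in>I. w i * l i y)"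
proof (cases "S = {}")
  case False
  \<comment> \<open>\<open>Q\<close> is the squared Euclidean norm of the image of a point under the
    maps \<open>l i\<close>.\<close>
  define Q where "Q y = (\<Sum>i\<in>I. (l i y)\<^sup>2)" for y
  define m where "m = Inf (Q ` S)"
  have bdd: "bdd_below (Q ` S)"
    by (rule bdd_belowI[of _ 0]) (auto simp: Q_def sum_nonneg)
  have m_le: "m \<le> Q y" if "y \<in> S" for y
    unfolding m_def using that bdd by (simp add: cInf_lower)
  have e_le: "e \<le> m"
    unfolding m_def using False away by (intro cInf_greatest) (auto simp: Q_def)
  have "\<exists>y\<in>S. Q y < m + 1 / real (Suc n)" for n
    using cInf_lessD[of "Q ` S" "m + 1 / real (Suc n)"] False by (auto simp: m_def)
  then obtain k where kS: "\<And>n. k n \<in> S" and kQ: "\<And>n. Q (k n) < m + 1 / real (Suc n)"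
    by metis
  have Q_lim: "(\<lambda>n. Q (k n)) \<longlonglongrightarrow> m"
  proof (rule tendsto_sandwich[of "\<lambda>_. m"])
    have "(\<lambda>n. m + 1 / real (Suc n)) \<longlonglongrightarrow> m + 0"
      by (intro tendsto_add tendsto_const LIMSEQ_Suc[OF lim_1_over_n])
    then show "(\<lambda>n. m + 1 / real (Suc n)) \<longlonglongrightarrow> m" by simp
    show "\<forall>\<^sub>F n in sequentially. m \<le> Q (k n)"
      using m_le kS by simp
    show "\<forall>\<^sub>F n in sequentially. Q (k n) \<le> m + 1 / real (Suc n)"
      using kQ by (simp add: less_imp_le)
  qed simp
  \<comment> \<open>The identity is written with the midpoint because convexity keeps it in
    \<open>S\<close>, where \<open>Q\<close> is at least \<open>m\<close>.\<close>
  have parallelogram: "Q (a - b) = 2 * Q a + 2 * Q b - 4 * Q ((1/2) *\<^sub>R a + (1/2) *\<^sub>R b)" for a b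
  proof -
    have "Q (a - b) = (\<Sum>i\<in>I. 2 * (l i a)\<^sup>2 + 2 * (l i b)\<^sup>2 - 4 * (l i ((1/2) *\<^sub>R a + (1/2) *\<^sub>R b))\<^sup>2)"
      unfolding Q_def
    proof (rule sum.cong[OF refl])
      fix i
      assume "i \<in> I"
      then interpret linear "l i" by (rule lin)
      show "(l i (a - b))\<^sup>2 = 2 * (l i a)\<^sup>2 + 2 * (l i b)\<^sup>2 - 4 * (l i ((1/2) *\<^sub>R a + (1/2) *\<^sub>R b))\<^sup>2"
        unfolding diff add scale by (simp add: power2_eq_square field_simps)
    qed
    then show ?thesis
      by (simp add: Q_def sum.distrib sum_subtractf sum_distrib_left)
  qed
  have dist_bound: "(l i (k a) - l i (k b))\<^sup>2 \<le> 2 * (1 / real (Suc a)) + 2 * (1 / real (Suc b))"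
    if "i \<in> I" for i a b
  proof -
    have "(l i (k a) - l i (k b))\<^sup>2 \<le> Q (k a - k b)"
      unfolding Q_def using that assms(2) lin
      by (subst linear_diff[symmetric]) (auto intro: member_le_sum)
    moreover have "(1/2) *\<^sub>R k a + (1/2) *\<^sub>R k b \<in> S"
      using assms(1) kS by (simp add: convex_def)
    ultimately show ?thesis
      using m_le[of "(1/2) *\<^sub>R k a + (1/2) *\<^sub>R k b"] kQ[of a] kQ[of b] parallelogram[of "k a" "k b"]
      by linarith
  qed
  have "convergent (\<lambda>n. l i (k n))" if "i \<in> I" for i
  proof (rule Cauchy_convergent, rule metric_CauchyI)
    fix r :: real
    assume "0 < r"
    \<comment> \<open>The factor 4 collects the two terms of \<open>dist_bound\<close>, each at most
      \<open>2 / Suc N\<close>.\<close>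
    then obtain N where N: "inverse (real (Suc N)) < r\<^sup>2 / 4"
      using reals_Archimedean[of "r\<^sup>2 / 4"] by auto
    have "dist (l i (k a)) (l i (k b)) < r" if "N \<le> a" "N \<le> b" for a b
    proof -
      have "1 / real (Suc a) \<le> inverse (real (Suc N))" "1 / real (Suc b) \<le> inverse (real (Suc N))"
        using that by (auto simp: inverse_eq_divide intro!: divide_left_mono)
      then have "(l i (k a) - l i (k b))\<^sup>2 < r\<^sup>2"
        using dist_bound[OF \<open>i \<in> I\<close>, of a b] N by linarith
      then show ?thesis
        unfolding dist_real_def
        using \<open>0 < r\<close> abs_le_square_iff[of r "l i (k a) - l i (k b)"] by linarith
    qed
    then show "\<exists>N. \<forall>a\<ge>N. \<forall>b\<ge>N. dist (l i (k a)) (l i (k b)) < r"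
      by blast
  qed
  then obtain w where w: "\<And>i. i \<in> I \<Longrightarrow> (\<lambda>n. l i (k n)) \<longlonglongrightarrow> w i"
    unfolding convergent_def by metis
  have "(\<lambda>n. Q (k n)) \<longlonglongrightarrow> (\<Sum>i\<in>I. (w i)\<^sup>2)"
    unfolding Q_def by (intro tendsto_intros w)
  then have norm_w: "(\<Sum>i\<in>I. (w i)\<^sup>2) = m"
    using Q_lim LIMSEQ_unique by blast
  have "m \<le> (\<Sum>i\<in>I. w i * l i y)" if y: "y \<in> S" for y
  proof -
    \<comment> \<open>Points of the segment from \<open>k n\<close> to \<open>y\<close> lie in
      \<open>S\<close>, so \<open>Q\<close> is at least \<open>m\<close> there. Letting n tend to
      infinity puts \<open>w\<close> at the start of the segment although \<open>w\<close> may lie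
      only in the closure of the image.\<close>
    have "0 \<le> 2 * t * (\<Sum>i\<in>I. w i * (l i y - w i)) + t\<^sup>2 * (\<Sum>i\<in>I. (l i y - w i)\<^sup>2)"
      if t: "0 < t" "t \<le> 1" for t
    proof -
      have "m \<le> (\<Sum>i\<in>I. (l i (k n) + t * (l i y - l i (k n)))\<^sup>2)" for n
      proof -
        have "(1 - t) *\<^sub>R k n + t *\<^sub>R y \<in> S"
          using assms(1) kS y t by (simp add: convex_def)
        moreover have "Q ((1 - t) *\<^sub>R k n + t *\<^sub>R y) =
            (\<Sum>i\<in>I. (l i (k n) + t * (l i y - l i (k n)))\<^sup>2)"
          unfolding Q_def
        proof (rule sum.cong[OF refl])
          fix i
          assume "i \<in> I"
          then interpret linear "l i" by (rule lin)
          show "(l i ((1 - t) *\<^sub>R k n + t *\<^sub>R y))\<^sup>2 = (l i (k n) + t * (l i y - l i (k n)))\<^sup>2"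
            unfolding add scale by (simp add: algebra_simps)
        qed
        ultimately show ?thesis
          using m_le by metis
      qed
      moreover have "(\<lambda>n. \<Sum>i\<in>I. (l i (k n) + t * (l i y - l i (k n)))\<^sup>2)
          \<longlonglongrightarrow> (\<Sum>i\<in>I. (w i + t * (l i y - w i))\<^sup>2)"
        by (intro tendsto_intros w)
      ultimately have "m \<le> (\<Sum>i\<in>I. (w i + t * (l i y - w i))\<^sup>2)"
        by (intro LIMSEQ_le_const) auto
      then show ?thesis
        by (simp add: sum_power2_add norm_w)
    qed
    then have "0 \<le> (\<Sum>i\<in>I. w i * (l i y - w i))"
      by (rule linear_term_nonneg)
    \<comment> \<open>The variational inequality at the minimal point bounds its inner product with
      the image of \<open>y\<close> below by its squared norm \<open>m\<close>.\<close>
    then show ?thesis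
      using norm_w by (simp add: right_diff_distrib sum_subtractf power2_eq_square)
  qed
  then show ?thesis
    using e_le by (meson order_trans)
qed simp

section \<open>The weak* topology\<close>

lemma dual_apply_simps [simp]:
  "dual_apply 0 x = 0"
  "dual_apply (f + g) x = dual_apply f x + dual_apply g x"
  "dual_apply (- f) x = - dual_apply f x"
  "dual_apply (f - g) x = dual_apply f x - dual_apply g x"
  "dual_apply (c *\<^sub>R f) x = c * dual_apply f x"
  by (transfer; simp)+

lemma continuous_on_dual_eval: "continuous_on S (\<lambda>f. dual_apply f x)"
proof -
  have "continuous_on UNIV dual_apply"
    unfolding continuous_on_open_vimage[OF open_UNIV] by (auto simp: open_dual_def)
  then have "continuous_on UNIV (\<lambda>f. dual_apply f x)"
    by (rule continuous_on_product_then_coordinatewise)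
  then show ?thesis
    by (rule continuous_on_subset) simp
qed

text \<open>A basic open box of the product topology restricts only finitely many coordinates, so
  one radius serves for all of them.\<close>

lemma open_dual_contains_basis:
  fixes A :: "'a::locally_convex_t2 dual set"
  assumes "open A" "p \<in> A"
  shows "\<exists>I e. finite I \<and> 0 < e \<and>
    {f. \<forall>x\<in>I. \<bar>dual_apply f x - dual_apply p x\<bar> < e} \<subseteq> A"
proof -
  obtain W where W: "open W" "A = dual_apply -` W"
    using assms(1) by (auto simp: open_dual_def)
  obtain X where X: "dual_apply p \<in> Pi\<^sub>E UNIV X" "\<And>x. open (X x)"
      "finite {x. X x \<noteq> UNIV}" "Pi\<^sub>E UNIV X \<subseteq> W"
    using product_topology_open_contains_basis[of "\<lambda>_. euclidean" UNIV W "dual_apply p"] W assms(2)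
    by (auto simp: open_fun_def)
  define I where "I = {x. X x \<noteq> UNIV}"
  have "\<exists>e>0. \<forall>r. \<bar>r - dual_apply p x\<bar> < e \<longrightarrow> r \<in> X x" for x
    using X(1) X(2)[of x] by (auto simp: open_dist dist_real_def PiE_iff)
  then obtain d where d: "\<And>x. 0 < d x" "\<And>x r. \<bar>r - dual_apply p x\<bar> < d x \<Longrightarrow> r \<in> X x"
    by metis
  \<comment> \<open>Inserting 1 keeps the minimum defined and positive when \<open>I\<close> is
    empty.\<close>
  define e where "e = Min (insert 1 (d ` I))"
  have I: "finite I"
    using X(3) by (simp add: I_def)
  then have e: "0 < e" "\<And>x. x \<in> I \<Longrightarrow> e \<le> d x"
    using d(1) by (auto simp: e_def)
  have "f \<in> A" if f: "\<forall>x\<in>I. \<bar>dual_apply f x - dual_apply p x\<bar> < e" for f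
  proof -
    have "dual_apply f x \<in> X x" for x
    proof (cases "x \<in> I")
      case True
      then show ?thesis
        using f e(2) d(2) by (meson less_le_trans)
    qed (simp add: I_def)
    then show ?thesis
      using X(4) W(2) by (auto simp: PiE_iff)
  qed
  then show ?thesis
    using I e(1) by blast
qed

text \<open>A basic neighbourhood of \<open>p\<close> missing \<open>K\<close> is given by finitely
  many evaluations and the real coordinate. Under these maps the image of \<open>K - p\<close> stays
  away from 0, and the finite-dimensional separation applies.\<close>

lemma weak_star_separation:
  fixes K :: "('a::locally_convex_t2 dual \<times> real) set"
  assumes "closed K" "convex K" "p \<notin> K"
  shows "\<exists>x t. \<forall>(f, r)\<in>K. dual_apply (fst p) x + t * snd p < dual_apply f x + t * r"
proof -
  obtain A B where AB: "open A" "open B" "p \<in> A \<times> B" "A \<times> B \<subseteq> - K"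
    using assms(1,3) by (metis ComplI open_Compl open_prod_elim)
  obtain I d where I: "finite I" "0 < d"
      "{f. \<forall>x\<in>I. \<bar>dual_apply f x - dual_apply (fst p) x\<bar> < d} \<subseteq> A"
    using open_dual_contains_basis[OF AB(1), of "fst p"] AB(3) by auto
  obtain d' where d': "0 < d'" "\<And>r. \<bar>r - snd p\<bar> < d' \<Longrightarrow> r \<in> B"
    using AB(2,3) by (auto simp: open_dist dist_real_def)
  define e where "e = min d d'"
  have e: "0 < e" "e \<le> d" "e \<le> d'"
    using I(2) d'(1) by (auto simp: e_def)
  \<comment> \<open>\<open>None\<close> indexes the real coordinate and \<open>Some x\<close> the
    evaluation at \<open>x\<close>.\<close>
  define l :: "'a option \<Rightarrow> 'a dual \<times> real \<Rightarrow> real" where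
    "l i y = (case i of None \<Rightarrow> snd y | Some x \<Rightarrow> dual_apply (fst y) x)" for i y
  define J where "J = insert None (Some ` I)"
  have lin: "linear (l i)" for i
    by (cases i) (auto simp: l_def intro!: linearI)
  have J: "finite J"
    using I(1) by (simp add: J_def)
  have "\<exists>w. \<forall>y\<in>(\<lambda>y. y - p) ` K. e\<^sup>2 \<le> (\<Sum>i\<in>J. w i * l i y)"
  proof (rule separate_zero_finite_functionals[OF _ J lin])
    show "convex ((\<lambda>y. y - p) ` K)"
      using assms(2) by simp
    fix y
    assume "y \<in> (\<lambda>y. y - p) ` K"
    then have "y + p \<notin> A \<times> B"
      using AB(4) by auto
    moreover have "y + p \<in> A \<times> B" if "\<forall>i\<in>J. \<bar>l i y\<bar> < e"
    proof -
      have "fst y + fst p \<in> A"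
        using I(3) that e(2) by (fastforce simp: J_def l_def)
      moreover have "snd y + snd p \<in> B"
        using d'(2) that e(3) by (fastforce simp: J_def l_def)
      ultimately show ?thesis
        by (simp add: mem_Times_iff)
    qed
    ultimately obtain i where i: "i \<in> J" "e \<le> \<bar>l i y\<bar>"
      by force
    then have "e\<^sup>2 \<le> (l i y)\<^sup>2"
      using e(1) by (metis abs_le_square_iff abs_of_pos)
    also have "\<dots> \<le> (\<Sum>i\<in>J. (l i y)\<^sup>2)"
      using i(1) J by (auto intro: member_le_sum)
    finally show "e\<^sup>2 \<le> (\<Sum>i\<in>J. (l i y)\<^sup>2)" .
  qed
  then obtain w where w: "\<And>y. y \<in> K \<Longrightarrow> e\<^sup>2 \<le> (\<Sum>i\<in>J. w i * l i (y - p))"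
    by blast
  \<comment> \<open>By linearity of each dual element, the weighted sum of evaluations is a single
    evaluation at this vector.\<close>
  define x where "x = (\<Sum>x\<in>I. w (Some x) *\<^sub>R x)"
  have "(\<Sum>i\<in>J. w i * l i y) = dual_apply (fst y) x + w None * snd y" for y
    using I(1)
    by (simp add: J_def l_def x_def sum.reindex linear_sum[OF linear_dual_apply]
        linear_scale[OF linear_dual_apply])
  then have "e\<^sup>2 \<le> dual_apply (fst y - fst p) x + w None * (snd y - snd p)" if "y \<in> K" for y
    using w[OF that] by simp
  moreover have "0 < e\<^sup>2"
    using e(1) by simp
  ultimately have "dual_apply (fst p) x + w None * snd p < dual_apply (fst y) x + w None * snd y"
    if "y \<in> K" for y
    using that by (smt (verit) dual_apply_simps(4) right_diff_distrib)
  then show ?thesis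
    by (intro exI[of _ x] exI[of _ "w None"]) auto
qed

section \<open>Farkas' lemma for linear inequality systems\<close>

definition solutions :: "('a::locally_convex_t2 dual \<times> real) set \<Rightarrow> 'a set" where
  "solutions B = {x. \<forall>(f, r)\<in>B. dual_apply f x \<le> r}"

definition consequences :: "('a::locally_convex_t2 dual \<times> real) set \<Rightarrow> ('a dual \<times> real) set" where
  "consequences B = {(f, r). \<forall>x\<in>solutions B. dual_apply f x \<le> r}"

text \<open>The set in (ii), known as the characteristic cone of the system. It need not be convex,
  since the generated cone is not convexified.\<close>

definition char_cone :: "('a::locally_convex_t2 dual \<times> real) set \<Rightarrow> ('a dual \<times> real) set" where
  "char_cone B = generated_cone B + {\<mu> *\<^sub>R (0, 1) |\<mu>. \<mu> \<ge> 0}"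

text \<open>The vertical ray absorbs the slack \<open>s - \<mu> * r\<close>, turning an equation in
  the real coordinate into an inequality. This is the form of (\<beta>'').\<close>

lemma mem_char_cone_iff:
  "(g, s) \<in> char_cone B \<longleftrightarrow> (\<exists>(f, r)\<in>B. \<exists>\<mu>\<ge>0. \<mu> *\<^sub>R f = g \<and> \<mu> * r \<le> s)"
proof
  assume "(g, s) \<in> char_cone B"
  then obtain f r \<mu> \<nu> where "(f, r) \<in> B" "0 \<le> \<mu>" "0 \<le> \<nu>"
      "(g, s) = \<mu> *\<^sub>R (f, r) + \<nu> *\<^sub>R (0, 1)"
    unfolding char_cone_def generated_cone_def set_plus_def by auto
  then show "\<exists>(f, r)\<in>B. \<exists>\<mu>\<ge>0. \<mu> *\<^sub>R f = g \<and> \<mu> * r \<le> s"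
    by (intro bexI[of _ "(f, r)"]) auto
next
  assume "\<exists>(f, r)\<in>B. \<exists>\<mu>\<ge>0. \<mu> *\<^sub>R f = g \<and> \<mu> * r \<le> s"
  then obtain f r \<mu> where *: "(f, r) \<in> B" "0 \<le> \<mu>" "\<mu> *\<^sub>R f = g" "\<mu> * r \<le> s"
    by blast
  have "\<mu> *\<^sub>R (f, r) \<in> generated_cone B"
    using * by (auto simp: generated_cone_def)
  moreover have "(s - \<mu> * r) *\<^sub>R (0, 1) \<in> {\<mu> *\<^sub>R (0 :: 'a dual, 1 :: real) |\<mu>. \<mu> \<ge> 0}"
    using *(4) by (intro CollectI exI[of _ "s - \<mu> * r"]) simp
  ultimately have "\<mu> *\<^sub>R (f, r) + (s - \<mu> * r) *\<^sub>R (0, 1) \<in> char_cone B"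
    unfolding char_cone_def by (rule set_plus_intro)
  then show "(g, s) \<in> char_cone B"
    using *(3) by simp
qed

lemma char_cone_scaleR:
  assumes "(g, s) \<in> char_cone B" "0 \<le> \<nu>"
  shows "(\<nu> *\<^sub>R g, \<nu> * s) \<in> char_cone B"
proof -
  obtain f r \<mu> where *: "(f, r) \<in> B" "0 \<le> \<mu>" "\<mu> *\<^sub>R f = g" "\<mu> * r \<le> s"
    using assms(1) by (auto simp: mem_char_cone_iff)
  then have "(\<nu> * \<mu>) *\<^sub>R f = \<nu> *\<^sub>R g" "(\<nu> * \<mu>) * r \<le> \<nu> * s" "0 \<le> \<nu> * \<mu>"
    using assms(2) by (auto simp: mult.assoc intro: mult_left_mono)
  then show ?thesis
    using *(1) unfolding mem_char_cone_iff by blast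
qed

lemma subset_char_cone: "B \<subseteq> char_cone B"
proof clarify
  fix f r
  assume "(f, r) \<in> B"
  then show "(f, r) \<in> char_cone B"
    unfolding mem_char_cone_iff by (intro bexI[of _ "(f, r)"]) (auto intro: exI[of _ 1])
qed

lemma vertical_mem_char_cone:
  assumes "B \<noteq> {}" "0 \<le> s"
  shows "(0, s) \<in> char_cone B"
proof -
  obtain f r where "(f, r) \<in> B"
    using assms(1) by auto
  then show ?thesis
    unfolding mem_char_cone_iff using assms(2)
    by (intro bexI[of _ "(f, r)"]) (auto intro: exI[of _ 0])
qed

text \<open>The easy half of Farkas' lemma: multiply one inequality of the system by \<mu> and relax
  its right-hand side.\<close>

lemma char_cone_subset_consequences: "char_cone B \<subseteq> consequences B"
proof clarify
  fix g s
  assume "(g, s) \<in> char_cone B"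
  then obtain f r \<mu> where *: "(f, r) \<in> B" "0 \<le> \<mu>" "\<mu> *\<^sub>R f = g" "\<mu> * r \<le> s"
    by (auto simp: mem_char_cone_iff)
  have "dual_apply g x \<le> s" if "x \<in> solutions B" for x
  proof -
    have "dual_apply f x \<le> r"
      using that *(1) by (auto simp: solutions_def)
    then have "\<mu> * dual_apply f x \<le> \<mu> * r"
      using *(2) by (rule mult_left_mono)
    then show ?thesis
      using *(3,4) by auto
  qed
  then show "(g, s) \<in> consequences B"
    by (simp add: consequences_def)
qed

text \<open>Each solution contributes a weak*-closed half-space, and the set is their
  intersection.\<close>

lemma closed_consequences: "closed (consequences B)"
proof -
  have "consequences B = (\<Inter>x\<in>solutions B. {y. dual_apply (fst y) x \<le> snd y})"
    by (auto simp: consequences_def)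
  moreover have "closed {y :: 'a dual \<times> real. dual_apply (fst y) x \<le> snd y}" for x
    by (intro closed_Collect_le continuous_on_compose2[OF continuous_on_dual_eval[of UNIV]]
        continuous_intros) auto
  ultimately show ?thesis
    by auto
qed

lemma convex_consequences: "convex (consequences B)"
  unfolding convex_def consequences_def
  by (auto intro!: add_mono mult_left_mono)

lemma consequences_subset_char_cone:
  fixes B :: "('a::locally_convex_t2 dual \<times> real) set"
  assumes "closed (char_cone B)" "convex (char_cone B)" "B \<noteq> {}" "solutions B \<noteq> {}"
  shows "consequences B \<subseteq> char_cone B"
proof (rule ccontr)
  assume "\<not> ?thesis"
  then obtain g s where gs: "(g, s) \<in> consequences B" "(g, s) \<notin> char_cone B"
    by auto
  then obtain x t where sep:
    "\<And>f r. (f, r) \<in> char_cone B \<Longrightarrow> dual_apply g x + t * s < dual_apply f x + t * r"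
    using weak_star_separation[OF assms(1,2)] by fastforce
  have neg: "dual_apply g x + t * s < 0"
    using sep[OF vertical_mem_char_cone[OF assms(3)], of 0] by simp
  have nonneg: "0 \<le> dual_apply f x + t * r" if fr: "(f, r) \<in> char_cone B" for f r
  proof (rule ccontr)
    assume *: "\<not> ?thesis"
    \<comment> \<open>Scaling by this factor makes the value on the cone equal to the value at
      \<open>(g, s)\<close>, which contradicts strict separation.\<close>
    define \<nu> where "\<nu> = (dual_apply g x + t * s) / (dual_apply f x + t * r)"
    have "0 \<le> \<nu>"
      using neg * by (simp add: \<nu>_def divide_nonpos_neg)
    from sep[OF char_cone_scaleR[OF fr this]]
    have "dual_apply g x + t * s < \<nu> * (dual_apply f x + t * r)"
      by (simp add: algebra_simps)
    then show False
      using * by (simp add: \<nu>_def)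
  qed
  have nonneg_B: "0 \<le> dual_apply f x + t * r" if "(f, r) \<in> B" for f r
    using nonneg subset_char_cone that by blast
  have bound: "dual_apply g z \<le> s" if "z \<in> solutions B" for z
    using gs(1) that by (auto simp: consequences_def)
  have "0 \<le> t"
    using nonneg[OF vertical_mem_char_cone[OF assms(3)], of 1] by simp
  then consider "t = 0" | "0 < t" by linarith
  then show False
  proof cases
    case 1
    obtain z where z: "z \<in> solutions B"
      using assms(4) by blast
    \<comment> \<open>With \<open>t = 0\<close>, every \<open>f\<close> of the system is nonnegative
      at \<open>x\<close>, so moving along \<open>- x\<close> preserves all inequalities.\<close>
    have "z - \<nu> *\<^sub>R x \<in> solutions B" if "0 \<le> \<nu>" for \<nu>
    proof -
      have "dual_apply f (z - \<nu> *\<^sub>R x) \<le> r" if "(f, r) \<in> B" for f r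
      proof -
        have "dual_apply f z \<le> r"
          using z that by (auto simp: solutions_def)
        moreover have "0 \<le> \<nu> * dual_apply f x"
          using nonneg_B[OF that] 1 \<open>0 \<le> \<nu>\<close> by simp
        ultimately show ?thesis
          by (simp add: linear_diff[OF linear_dual_apply] linear_scale[OF linear_dual_apply])
      qed
      then show ?thesis
        by (auto simp: solutions_def)
    qed
    from bound[OF this]
    have *: "dual_apply g z - \<nu> * dual_apply g x \<le> s" if "0 \<le> \<nu>" for \<nu>
      using that by (simp add: linear_diff[OF linear_dual_apply] linear_scale[OF linear_dual_apply])
    \<comment> \<open>Chosen so that \<open>g\<close> takes the value \<open>s + 1\<close> at
      \<open>z - \<nu> *\<^sub>R x\<close>.\<close>
    define \<nu> where "\<nu> = (dual_apply g z - s - 1) / dual_apply g x"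
    have "0 \<le> \<nu>"
      using bound[OF z] neg 1 by (simp add: \<nu>_def divide_nonpos_neg)
    from *[OF this] show False
      using neg 1 by (simp add: \<nu>_def)
  next
    case 2
    \<comment> \<open>Dividing the separating inequalities by \<open>t\<close> turns them into
      bounds on the values at \<open>- x / t\<close>: at most \<open>r\<close> on the system, but
      above \<open>s\<close> for \<open>g\<close>.\<close>
    have eval: "dual_apply f ((- 1 / t) *\<^sub>R x) = - dual_apply f x / t" for f
      by (simp only: linear_scale[OF linear_dual_apply]) simp
    have "(- 1 / t) *\<^sub>R x \<in> solutions B"
    proof -
      have "dual_apply f ((- 1 / t) *\<^sub>R x) \<le> r" if "(f, r) \<in> B" for f r
        using nonneg_B[OF that] 2
        unfolding eval by (simp add: field_simps)
      then show ?thesis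
        by (auto simp: solutions_def)
    qed
    from bound[OF this] show False
      using neg 2 unfolding eval by (simp add: field_simps)
  qed
qed

lemma char_cone_eq_consequences_iff:
  assumes "B \<noteq> {}" "solutions B \<noteq> {}"
  shows "char_cone B = consequences B \<longleftrightarrow> closed (char_cone B) \<and> convex (char_cone B)"
  using closed_consequences convex_consequences char_cone_subset_consequences
    consequences_subset_char_cone[OF _ _ assms] by (metis subset_antisym)

section \<open>Support-function inequalities as systems of linear inequalities\<close>

lemma support_fun_le_iff: "support_fun A x \<le> ereal b \<longleftrightarrow> (\<forall>f\<in>A. dual_apply f x \<le> b)"
  by (simp add: support_fun_def SUP_le_iff)

lemma mem_solutions_pair_sets_iff:
  "x \<in> solutions (\<Union>V\<in>\<VV>. pair_set V) \<longleftrightarrow> (\<forall>(A, b)\<in>\<VV>. support_fun A x \<le> ereal b)"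
  by (fastforce simp: solutions_def pair_set_def support_fun_le_iff)

theorem corollary6p3:
  fixes T :: "'i set"
    and \<U> :: "'i \<Rightarrow> ('a::locally_convex_t2 dual set \<times> real) set"
    and \<VV> :: "('a dual set \<times> real) set"
  assumes "T \<noteq> {}"
    and "\<And>t. t \<in> T \<Longrightarrow> \<U> t \<noteq> {}"
    and "\<And>t. t \<in> T \<Longrightarrow> \<U> t \<subseteq> P0_dual \<times> UNIV"
    and "\<VV> = (\<Union>t\<in>T. \<U> t)"
    and "\<exists>x. \<forall>(A, b)\<in>\<VV>. support_fun A x \<le> ereal b"
  shows "(\<forall>(c :: 'a dual) (s :: real).
            (\<forall>x. (\<forall>t\<in>T. \<forall>(A, b)\<in>\<U> t. support_fun A x \<le> ereal b) \<longrightarrow> dual_apply c x \<ge> s)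
            \<longleftrightarrow>
            (\<exists>V\<in>\<VV>. \<exists>(x', r)\<in>pair_set V. \<exists>\<mu>\<ge>0. \<mu> *\<^sub>R x' = - c \<and> \<mu> * r \<le> - s))
         \<longleftrightarrow>
         (closed (generated_cone (\<Union>V\<in>\<VV>. pair_set V) + {\<mu> *\<^sub>R (0 :: 'a dual, 1 :: real) |\<mu>. \<mu> \<ge> 0})
          \<and> convex (generated_cone (\<Union>V\<in>\<VV>. pair_set V) + {\<mu> *\<^sub>R (0 :: 'a dual, 1 :: real) |\<mu>. \<mu> \<ge> 0}))"
proof -
  define B where "B = (\<Union>V\<in>\<VV>. pair_set V)"
  obtain x0 where "x0 \<in> solutions B"
    using assms(5) by (auto simp: B_def mem_solutions_pair_sets_iff)
  then have sol: "solutions B \<noteq> {}"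
    by blast
  have nonempty: "B \<noteq> {}"
    using assms(1-4) by (fastforce simp: B_def pair_set_def P0_dual_def)
  have sol_iff: "(\<forall>t\<in>T. \<forall>(A, b)\<in>\<U> t. support_fun A x \<le> ereal b) \<longleftrightarrow> x \<in> solutions B" for x
    by (simp add: B_def mem_solutions_pair_sets_iff assms(4) del: UN_simps)
  have \<alpha>: "(\<forall>x. (\<forall>t\<in>T. \<forall>(A, b)\<in>\<U> t. support_fun A x \<le> ereal b) \<longrightarrow> dual_apply c x \<ge> s)
      \<longleftrightarrow> (- c, - s) \<in> consequences B" for c s
    unfolding sol_iff by (auto simp: consequences_def)
  have \<beta>: "(\<exists>V\<in>\<VV>. \<exists>(x', r)\<in>pair_set V. \<exists>\<mu>\<ge>0. \<mu> *\<^sub>R x' = - c \<and> \<mu> * r \<le> - s)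
      \<longleftrightarrow> (- c, - s) \<in> char_cone B" for c s
    by (simp add: mem_char_cone_iff B_def)
  \<comment> \<open>Negation is a bijection on pairs, so agreement at all \<open>(- c, - s)\<close>
    is equality of the two sets.\<close>
  have "(\<forall>c s. (- c, - s) \<in> consequences B \<longleftrightarrow> (- c, - s) \<in> char_cone B)
      \<longleftrightarrow> char_cone B = consequences B"
    by (metis add.inverse_inverse subset_antisym subrelI)
  then show ?thesis
    using char_cone_eq_consequences_iff[OF nonempty sol]
    unfolding \<alpha> \<beta> by (simp only: char_cone_def B_def)
qed

end
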